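(* Let $n\ge 1$ be an integer and $0\le r\le 3n$. Let $\alpha_r$ be the number of distinct permutations of the multiset consisting of four copies of each integer $1,\dots,n$ that have exactly $r$ matches. Then $$\alpha_r=\sum_{\substack{s+t+u+v+w=n\\ t+2u+2v+3w\ge r}}(-1)^{t+w-r}\binom{t+2u+2v+3w}{r}\binom{n}{s,t,u,v,w}\frac{(4s+3t+2u+2v+w)!}{(4!)^s(2!)^t(2!)^v},$$ where the sum is over all nonnegative integers $s,t,u,v,w$ satisfying the indicated conditions.
   Context: A permutation of the multiset is a sequence $(a_1,\dots,a_{4n})$ in which each of $1,\dots,n$ appears exactly four times (there are $(4n)!/(4!)^n$ of these). The number of matches of such a sequence is the number of indices $i$ with $1\le i\le 4n-1$ and $a_i=a_{i+1}$. $\binom{n}{s,t,u,v,w}=\frac{n!}{s!\,t!\,u!\,v!\,w!}$ is the multinomial coefficient. *)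

theory Defs
  imports Complex_Main "HOL-Combinatorics.Multiset_Permutations"
begin

definition four_copies :: "nat \<Rightarrow> nat multiset" where
  "four_copies n = (\<Sum>i\<in>{1..n}. replicate_mset 4 i)"

(* List positions are counted from 0, so i ranges over 0, ..., length xs - 2. *)
definition matches :: "'a list \<Rightarrow> nat" where
  "matches xs = card {i. Suc i < length xs \<and> xs ! i = xs ! Suc i}"

definition alpha :: "nat \<Rightarrow> nat \<Rightarrow> nat" where
  "alpha n r = card {xs \<in> permutations_of_multiset (four_copies n). matches xs = r}"

(* The multinomial coefficient; only meaningful when s + t + u + v + w = n. *)
definition multinomial5 :: "nat \<Rightarrow> nat \<Rightarrow> nat \<Rightarrow> nat \<Rightarrow> nat \<Rightarrow> nat \<Rightarrow> real" where
  "multinomial5 n s t u v w = fact n / (fact s * fact t * fact u * fact v * fact w)"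

end

theory Submission
  imports Defs
begin

text \<open>
  The formula is an inclusion-exclusion count. Choosing some of the matches of a word and gluing
  the two letters of each chosen match cuts the word into blocks of equal consecutive letters: a
  blocking of the word. A blocking is a list of pairs (letter, length) with positive lengths, and
  a block of length $l$ uses up $l - 1$ chosen matches. A word with $q$ matches therefore has
  $\binom{q}{m}$ blockings in which $m$ matches are chosen (\<open>sum_blockings\<close>), and by
  binomial inversion (\<open>binomial_orthogonality\<close>) a signed sum over the blockings of
  a word with weight $(-1)^{m-r}\binom{m}{r}$ is $1$ or $0$ according to whether the word has
  exactly $r$ matches.

  It remains to count blockings rather than words, and these have no adjacency condition: a blocking
  of some word with $k$ copies of each letter is just any arrangement of a multiset of blocks in
  which the lengths of the blocks of each letter form a partition of $k$
  (\<open>blockings_copies\<close>). For a fixed choice of partitions the number of arrangements is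
  the factorial of the number of blocks, divided by factorials for the equal blocks
  (\<open>sum_permutations_partitions\<close>).

  For $k = 4$ there are five partitions (\<open>partitions_4\<close>), namely $1+1+1+1$, $2+1+1$,
  $3+1$, $2+2$ and $4$. If $s, t, u, v, w$ letters respectively use them, there are
  $4s+3t+2u+2v+w$ blocks, $t+2u+2v+3w$ chosen matches, and equal blocks contribute
  $(4!)^s (2!)^t (2!)^v$ to the denominator. The multinomial coefficient counts the ways to
  distribute the partitions over the letters (\<open>sum_lists_by_counts\<close>).
\<close>

section \<open>Blockings of a word\<close>

definition expand :: "('a \<times> nat) list \<Rightarrow> 'a list" where
  "expand bs = concat (map (\<lambda>(v, l). replicate l v) bs)"

definition excess :: "('a \<times> nat) list \<Rightarrow> nat" where
  "excess bs = (\<Sum>b\<leftarrow>bs. snd b - 1)"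

text \<open>
  Only positive lengths are allowed: blocks of length zero would give every word infinitely many
  blockings.
\<close>

definition blockings :: "'a list \<Rightarrow> ('a \<times> nat) list set" where
  "blockings xs = {bs. expand bs = xs \<and> (\<forall>b\<in>set bs. 0 < snd b)}"

definition grow :: "('a \<times> nat) list \<Rightarrow> ('a \<times> nat) list" where
  "grow bs = (case bs of [] \<Rightarrow> [] | (v, l) # cs \<Rightarrow> (v, Suc l) # cs)"

lemma expand_simps [simp]:
  "expand [] = []" "expand ((v, l) # bs) = replicate l v @ expand bs"
  by (simp_all add: expand_def)

lemma excess_simps [simp]:
  "excess [] = 0" "excess ((v, l) # bs) = (l - 1) + excess bs"
  by (simp_all add: excess_def)

lemma matches_Cons_Cons:
  "matches (a # b # ys) = (if a = b then 1 else 0) + matches (b # ys)"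
proof -
  let ?M = "\<lambda>xs. {i. Suc i < length xs \<and> xs ! i = xs ! Suc i}"
  have "i \<in> ?M (a # b # ys) \<longleftrightarrow> i \<in> (if a = b then {0} else {}) \<union> Suc ` ?M (b # ys)" for i
    by (cases i) (auto simp: image_iff)
  then have eq: "?M (a # b # ys) = (if a = b then {0} else {}) \<union> Suc ` ?M (b # ys)"
    by blast
  have "finite (?M (b # ys))"
    by (rule finite_subset[of _ "{..length (b # ys)}"]) auto
  then show ?thesis
    unfolding matches_def eq by (subst card_Un_disjoint) (auto simp: card_image)
qed

lemma matches_short [simp]: "matches [] = 0" "matches [a] = 0"
  by (simp_all add: matches_def)

lemma blockings_Nil: "blockings [] = {[]}"
proof -
  have "bs = []" if "bs \<in> blockings []" for bs :: "('a \<times> nat) list"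
    using that by (cases bs) (auto simp: blockings_def)
  then show ?thesis by (auto simp: blockings_def)
qed

lemma blockings_Cons_cases:
  assumes "bs \<in> blockings (a # xs)"
  obtains l cs where "bs = (a, Suc l) # cs"
proof (cases bs)
  case Nil
  with assms show ?thesis by (simp add: blockings_def)
next
  case (Cons b cs)
  obtain v l where b: "b = (v, l)" by fastforce
  with assms Cons have "v = a" "l > 0" by (cases l; auto simp: blockings_def)+
  with Cons b that show ?thesis by (cases l) auto
qed

lemma Cons_in_blockings_Cons_iff:
  "(a, Suc l) # cs \<in> blockings (a # xs) \<longleftrightarrow>
     (if l = 0 then cs \<in> blockings xs else (a, l) # cs \<in> blockings xs)"
  by (auto simp: blockings_def)

lemma blockings_single: "blockings [a] = {[(a, 1)]}"
proof -
  have "bs = [(a, 1)]" if bs: "bs \<in> blockings [a]" for bs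
  proof -
    obtain l cs where eq: "bs = (a, Suc l) # cs" using blockings_Cons_cases[OF bs] by metis
    with bs show ?thesis
      by (auto simp: Cons_in_blockings_Cons_iff blockings_Nil split: if_splits)
  qed
  then show ?thesis by (auto simp: blockings_def)
qed

text \<open>
  The first letter either is a block of its own or, if it equals the second letter, joins the block
  that begins there. This is the dichotomy behind Pascal's rule in \<open>sum_blockings\<close>.
\<close>

lemma blockings_Cons_Cons:
  "blockings (a # b # ys) =
     Cons (a, 1) ` blockings (b # ys) \<union> (if a = b then grow ` blockings (b # ys) else {})"
  (is "?L = ?R")
proof
  show "?R \<subseteq> ?L"
  proof
    fix bs assume "bs \<in> ?R"
    then consider cs where "bs = (a, Suc 0) # cs" "cs \<in> blockings (b # ys)"
      | cs where "a = b" "bs = grow cs" "cs \<in> blockings (b # ys)"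
      by (cases "a = b") auto
    then show "bs \<in> ?L"
    proof cases
      case 1
      then show ?thesis by (simp add: Cons_in_blockings_Cons_iff)
    next
      case (2 cs)
      obtain l ds where "cs = (b, Suc l) # ds" using blockings_Cons_cases[OF 2(3)] by metis
      with 2 show ?thesis by (simp add: grow_def Cons_in_blockings_Cons_iff)
    qed
  qed
  show "?L \<subseteq> ?R"
  proof
    fix bs assume bs: "bs \<in> ?L"
    obtain l cs where eq: "bs = (a, Suc l) # cs" using blockings_Cons_cases[OF bs] by metis
    show "bs \<in> ?R"
    proof (cases l)
      case 0
      then show ?thesis using bs eq by (simp add: Cons_in_blockings_Cons_iff)
    next
      case (Suc m)
      then have mem: "(a, l) # cs \<in> blockings (b # ys)"
        using bs eq by (simp add: Cons_in_blockings_Cons_iff)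
      with Suc have "a = b" by (auto elim!: blockings_Cons_cases)
      moreover have "bs = grow ((a, l) # cs)" using eq by (simp add: grow_def)
      ultimately show ?thesis using mem by auto
    qed
  qed
qed

lemma finite_blockings: "finite (blockings xs)"
proof (induction xs rule: induct_list012)
  case (3 a b ys)
  then show ?case by (simp add: blockings_Cons_Cons)
qed (simp_all add: blockings_Nil blockings_single)

lemma sum_choose_Suc:
  fixes h :: "nat \<Rightarrow> real"
  shows "(\<Sum>m\<le>Suc k. real (Suc k choose m) * h m) = (\<Sum>m\<le>k. real (k choose m) * h m) + (\<Sum>m\<le>k. real (k choose m) * h (Suc m))"
proof -
  have "(\<Sum>m\<le>Suc k. real (Suc k choose m) * h m) = h 0 + (\<Sum>m\<le>k. real (Suc k choose Suc m) * h (Suc m))"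
    by (subst sum.atMost_Suc_shift) simp
  also have "\<dots> = h 0 + (\<Sum>m\<le>k. real (k choose Suc m) * h (Suc m)) + (\<Sum>m\<le>k. real (k choose m) * h (Suc m))"
    by (simp add: sum.distrib algebra_simps)
  also have "h 0 + (\<Sum>m\<le>k. real (k choose Suc m) * h (Suc m)) = (\<Sum>m\<le>Suc k. real (k choose m) * h m)"
    by (subst sum.atMost_Suc_shift) simp
  finally show ?thesis by (simp add: binomial_eq_0)
qed

text \<open>
  The blockings of a word correspond to the sets of chosen matches, and the excess is the number of
  chosen matches. Stating this for an arbitrary weight instead of counting the blockings of each
  excess lets the induction pass from \<open>h m\<close> to \<open>h (Suc m)\<close> when a
  match is chosen.
\<close>

lemma sum_blockings:
  fixes h :: "nat \<Rightarrow> real"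
  shows "(\<Sum>bs\<in>blockings xs. h (excess bs)) = (\<Sum>m\<le>matches xs. real (matches xs choose m) * h m)"
proof (induction xs arbitrary: h rule: induct_list012)
  case (3 a b ys)
  let ?B = "blockings (b # ys)"
  \<comment> \<open>Growing the first block raises the excess by one, since that block is nonempty already.\<close>
  have split_grow: "(\<Sum>bs\<in>grow ` ?B. h (excess bs)) = (\<Sum>bs\<in>?B. h (Suc (excess bs)))"
  proof (subst sum.reindex)
    show "inj_on grow ?B"
      by (auto simp: inj_on_def grow_def elim!: blockings_Cons_cases)
    show "sum ((\<lambda>bs. h (excess bs)) \<circ> grow) ?B = (\<Sum>bs\<in>?B. h (Suc (excess bs)))"
      by (rule sum.cong) (auto simp: grow_def elim!: blockings_Cons_cases)
  qed
  have disj: "Cons (a, 1) ` ?B \<inter> (if a = b then grow ` ?B else {}) = {}"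
    by (auto simp: grow_def elim!: blockings_Cons_cases)
  have "(\<Sum>bs\<in>blockings (a # b # ys). h (excess bs))
      = (\<Sum>bs\<in>?B. h (excess bs)) + (if a = b then \<Sum>bs\<in>?B. h (Suc (excess bs)) else 0)"
    unfolding blockings_Cons_Cons using disj
    by (subst sum.union_disjoint) (auto simp: finite_blockings sum.reindex split_grow)
  also have "\<dots> = (\<Sum>m\<le>matches (a # b # ys). real (matches (a # b # ys) choose m) * h m)"
    using 3(2)[of h] 3(2)[of "\<lambda>m. h (Suc m)"]
    by (simp add: matches_Cons_Cons sum_choose_Suc del: sum.atMost_Suc)
  finally show ?case .
qed (simp_all add: blockings_Nil blockings_single)

text \<open>
  Binomial inversion: the trinomial revision $\binom{k}{m}\binom{m}{r} = \binom{k}{r}\binom{k-r}{m-r}$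
  leaves an alternating row sum of Pascal's triangle, which vanishes unless the row is $k - r = 0$.
  For $m < r$ the truncated exponent is harmless, as the binomial coefficient is zero.
\<close>

lemma binomial_orthogonality:
  "(\<Sum>m\<le>k. real (k choose m) * ((-1) ^ (m - r) * real (m choose r))) = (if k = r then 1 else 0)"
proof (cases "r \<le> k")
  case True
  have "(\<Sum>m\<le>k. real (k choose m) * ((-1) ^ (m - r) * real (m choose r)))
      = (\<Sum>m\<in>{r..k}. real (k choose m) * ((-1) ^ (m - r) * real (m choose r)))"
    by (rule sum.mono_neutral_right) (auto simp: binomial_eq_0)
  also have "\<dots> = (\<Sum>m\<in>{r..k}. real (k choose r) * ((-1) ^ (m - r) * real (k - r choose (m - r))))"
  proof (rule sum.cong)
    fix m assume "m \<in> {r..k}"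
    then have "(k choose m) * (m choose r) = (k choose r) * (k - r choose (m - r))"
      by (intro choose_mult) auto
    then show "real (k choose m) * ((-1) ^ (m - r) * real (m choose r)) =
        real (k choose r) * ((-1) ^ (m - r) * real (k - r choose (m - r)))"
      by (simp add: mult.left_commute flip: of_nat_mult)
  qed simp
  also have "\<dots> = real (k choose r) * (\<Sum>j\<le>k - r. (-1) ^ j * real (k - r choose j))"
    unfolding sum_distrib_left
    by (rule sum.reindex_bij_witness[of _ "\<lambda>j. j + r" "\<lambda>m. m - r"]) (use True in auto)
  also have "\<dots> = (if k = r then 1 else 0)"
    using True choose_alternating_sum[of "k - r", where 'a = real] by (cases "k = r") auto
  finally show ?thesis .
qed (auto simp: binomial_eq_0 intro!: sum.neutral)

section \<open>Multisets of blocks and partitions\<close>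

text \<open>
  The block lengths of a single letter. A multiset of blocks is the same thing as its family of
  fibres, and the conditions on a blocking decouple into one condition per fibre.
\<close>

definition fibre :: "('a \<times> nat) multiset \<Rightarrow> 'a \<Rightarrow> nat multiset" where
  "fibre B v = image_mset snd (filter_mset (\<lambda>b. fst b = v) B)"

definition partitions :: "nat \<Rightarrow> nat multiset set" where
  "partitions k = {p. 0 \<notin># p \<and> sum_mset p = k}"

text \<open>
  The multiset of blocks whose fibres are prescribed by a list. Letters are numbered from $1$, list
  positions from $0$. Lists rather than functions on the letters are used because the lists with
  a given multiset of entries can later be counted as multiset permutations.
\<close>

definition assemble :: "nat multiset list \<Rightarrow> (nat \<times> nat) multiset" where
  "assemble ps = (\<Sum>i<length ps. image_mset (Pair (Suc i)) (ps ! i))"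

lemma count_fibre [simp]: "count (fibre B v) l = count B (v, l)"
  unfolding fibre_def by (induction B) auto

lemma multiset_eq_fibreI: "(\<And>v. fibre B v = fibre C v) \<Longrightarrow> B = C"
  by (metis count_fibre multiset_eqI surj_pair)

lemma count_expand: "count (mset (expand bs)) v = sum_mset (fibre (mset bs) v)"
  by (induction bs) (auto simp: fibre_def)

lemma fibre_sum: "finite I \<Longrightarrow> fibre (\<Sum>i\<in>I. B i) v = (\<Sum>i\<in>I. fibre (B i) v)"
  by (induction I rule: finite_induct) (auto simp: fibre_def)

lemma fibre_Pair: "fibre (image_mset (Pair w) p) v = (if v = w then p else {#})"
  unfolding fibre_def by (induction p) auto

lemma fibre_assemble:
  "fibre (assemble ps) v = (if v \<in> {1..length ps} then ps ! (v - 1) else {#})"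
proof -
  have "fibre (assemble ps) v = (\<Sum>i<length ps. if v = Suc i then ps ! i else {#})"
    unfolding assemble_def by (simp add: fibre_sum fibre_Pair)
  also have "\<dots> = (\<Sum>i<length ps. if i = v - 1 then (if v = 0 then {#} else ps ! i) else {#})"
    by (rule sum.cong) auto
  finally show ?thesis by auto
qed

lemma assemble_inject:
  assumes "assemble ps = assemble qs" "length ps = length qs"
  shows "ps = qs"
proof (rule nth_equalityI)
  fix i assume "i < length ps"
  then show "ps ! i = qs ! i"
    using fibre_assemble[of ps "Suc i"] fibre_assemble[of qs "Suc i"] assms by simp
qed (use assms in simp)

lemma assemble_fibres:
  assumes "\<And>v. v \<notin> {1..n} \<Longrightarrow> fibre B v = {#}"
  shows "assemble (map (\<lambda>i. fibre B (Suc i)) [0..<n]) = B"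
  by (rule multiset_eq_fibreI) (use assms in \<open>auto simp: fibre_assemble\<close>)

lemma sum_nth_conv_sum_mset: "(\<Sum>i<length ps. f (ps ! i)) = (\<Sum>p\<in>#mset ps. f p)"
  for f :: "'a \<Rightarrow> nat"
  by (simp add: sum_mset_sum_list sum_list_sum_nth atLeast0LessThan flip: mset_map)

lemma size_assemble: "size (assemble ps) = (\<Sum>p\<in>#mset ps. size p)"
  unfolding assemble_def by (simp add: size_multiset_sum flip: sum_nth_conv_sum_mset)

lemma excess_assemble:
  assumes "mset bs = assemble ps"
  shows "excess bs = (\<Sum>p\<in>#mset ps. \<Sum>l\<in>#p. l - 1)"
proof -
  have "excess bs = (\<Sum>b\<in>#mset bs. snd b - 1)"
    by (simp add: excess_def sum_mset_sum_list flip: mset_map)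
  also have "\<dots> = (\<Sum>i<length ps. \<Sum>l\<in>#ps ! i. l - 1)"
  proof -
    have "(\<Sum>b\<in>#(\<Sum>i\<in>I. image_mset (Pair (Suc i)) (ps ! i)). snd b - 1) =
      (\<Sum>i\<in>I. \<Sum>l\<in>#ps ! i. l - 1)" if "finite I" for I
      using that by (induction I rule: finite_induct) (auto simp: image_mset.compositionality o_def)
    then show ?thesis by (simp add: assms assemble_def)
  qed
  finally show ?thesis by (simp only: sum_nth_conv_sum_mset[of "\<lambda>p. \<Sum>l\<in>#p. l - 1"])
qed

text \<open>
  The number of permutations of the blocks of one letter that only exchange blocks of the same
  length.
\<close>

definition symmetry_factor :: "nat multiset \<Rightarrow> nat" where
  "symmetry_factor p = (\<Prod>l\<in>set_mset p. fact (count p l))"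

text \<open>
  Blocks of different letters are different, so the symmetry of the whole multiset of blocks is the
  product over the letters.
\<close>

lemma prod_fact_count_assemble:
  "(\<Prod>b\<in>set_mset (assemble ps). fact (count (assemble ps) b)) = (\<Prod>p\<in>#mset ps. symmetry_factor p)"
proof -
  let ?B = "assemble ps"
  have "v \<in> {1..length ps}" if "(v, l) \<in># ?B" for v l
    using that fibre_assemble[of ps v] count_fibre[of ?B v l]
    by (auto simp: count_eq_zero_iff split: if_splits)
  moreover have "l \<in># fibre ?B v \<longleftrightarrow> (v, l) \<in># ?B" for v l
    using count_fibre[of ?B v l] by (metis count_eq_zero_iff)
  ultimately have set: "set_mset ?B = (SIGMA v:{1..length ps}. set_mset (fibre ?B v))"
    by auto
  have "(\<Prod>b\<in>set_mset ?B. fact (count ?B b)) = (\<Prod>v\<in>{1..length ps}. symmetry_factor (fibre ?B v))"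
    unfolding set symmetry_factor_def by (simp add: prod.Sigma case_prod_beta)
  also have "\<dots> = (\<Prod>i<length ps. symmetry_factor (ps ! i))"
    by (rule prod.reindex_bij_witness[of _ Suc "\<lambda>v. v - 1"]) (auto simp: fibre_assemble)
  also have "\<dots> = (\<Prod>p\<in>#mset ps. symmetry_factor p)"
    by (simp add: prod_mset_prod_list prod.list_conv_set_nth atLeast0LessThan flip: mset_map)
  finally show ?thesis .
qed

definition copies :: "nat \<Rightarrow> nat \<Rightarrow> nat multiset" where
  "copies k n = (\<Sum>i\<in>{1..n}. replicate_mset k i)"

lemma count_copies: "count (copies k n) v = (if v \<in> {1..n} then k else 0)"
  unfolding copies_def by (simp add: count_sum)

text \<open>
  Whether a list of blocks expands to a word with the required letters depends only on the multiset
  of blocks: each letter $1, \dots, n$ must own a partition of $k$, and any other letter must own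
  a partition of $0$, hence no block at all.
\<close>

lemma blockings_copies:
  "(\<Union>xs\<in>permutations_of_multiset (copies k n). blockings xs) =
   (\<Union>ps\<in>{ps. set ps \<subseteq> partitions k \<and> length ps = n}. permutations_of_multiset (assemble ps))"
  (is "?L = ?R")
proof -
  have "bs \<in> ?L \<longleftrightarrow> bs \<in> ?R" for bs
  proof -
    \<comment> \<open>Positivity of the lengths, too, is a condition on the fibres.\<close>
    have pos: "(\<forall>b\<in>set bs. 0 < snd b) \<longleftrightarrow> (\<forall>v. 0 \<notin># fibre (mset bs) v)"
      by (force simp: fibre_def)
    have "bs \<in> ?L \<longleftrightarrow> (\<forall>v. 0 \<notin># fibre (mset bs) v) \<and> mset (expand bs) = copies k n"
      by (auto simp: blockings_def permutations_of_multiset_def simp flip: pos)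
    also have "\<dots> \<longleftrightarrow> (\<forall>v. fibre (mset bs) v \<in> partitions (count (copies k n) v))"
      by (auto simp: multiset_eq_iff count_expand partitions_def)
    also have "\<dots> \<longleftrightarrow> (\<forall>v. if v \<in> {1..n} then fibre (mset bs) v \<in> partitions k
                             else fibre (mset bs) v = {#})"
    proof -
      have "p \<in> partitions 0 \<longleftrightarrow> p = {#}" for p
        by (cases p) (auto simp: partitions_def)
      then show ?thesis by (intro all_cong1) (simp add: count_copies)
    qed
    also have "\<dots> \<longleftrightarrow> bs \<in> ?R"
    proof
      assume *: "\<forall>v. if v \<in> {1..n} then fibre (mset bs) v \<in> partitions k
                          else fibre (mset bs) v = {#}"
      let ?ps = "map (\<lambda>i. fibre (mset bs) (Suc i)) [0..<n]"
      have "assemble ?ps = mset bs" by (rule assemble_fibres) (use * in metis)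
      moreover have "set ?ps \<subseteq> partitions k" using * by auto
      ultimately show "bs \<in> ?R"
        by (intro UN_I[of ?ps]) (auto simp: permutations_of_multiset_def)
    next
      assume "bs \<in> ?R"
      then show "\<forall>v. if v \<in> {1..n} then fibre (mset bs) v \<in> partitions k
                          else fibre (mset bs) v = {#}"
        by (auto simp: permutations_of_multiset_def fibre_assemble subset_iff)
    qed
    finally show ?thesis .
  qed
  then show ?thesis by blast
qed

lemma finite_partitions: "finite (partitions k)"
proof (rule finite_subset)
  show "partitions k \<subseteq> (\<Union>j\<le>k. multisets_of_size {..k} j)"
  proof
    fix p assume p: "p \<in> partitions k"
    have "l \<le> sum_mset p" if "l \<in># p" for l
      using that by (metis sum_mset.remove le_add1)
    moreover have "size p \<le> sum_mset p" if "0 \<notin># p"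
      using that by (induction p) auto
    ultimately show "p \<in> (\<Union>j\<le>k. multisets_of_size {..k} j)"
      using p by (auto simp: partitions_def multisets_of_size_def)
  qed
  show "finite (\<Union>j\<le>k. multisets_of_size {..k} j)"
    by (intro finite_UN_I finite_multisets_of_size) simp_all
qed

text \<open>
  Exchange of the order of counting: the blockings of all words, grouped by word on the left-hand
  side and by the partitions used by the letters on the right-hand side. Within a group on the right
  the excess is constant, and the group is the set of all arrangements of one multiset.
\<close>

lemma sum_permutations_partitions:
  fixes h :: "nat \<Rightarrow> real"
  shows "(\<Sum>xs\<in>permutations_of_multiset (copies k n). \<Sum>m\<le>matches xs. real (matches xs choose m) * h m) =
    (\<Sum>ps\<in>{ps. set ps \<subseteq> partitions k \<and> length ps = n}.
       h (\<Sum>p\<in>#mset ps. \<Sum>l\<in>#p. l - 1) * (fact (\<Sum>p\<in>#mset ps. size p) / real (\<Prod>p\<in>#mset ps. symmetry_factor p)))"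
  (is "?lhs = sum ?F ?T")
proof -
  have fin: "finite ?T" using finite_lists_length_eq[OF finite_partitions] by simp
  have "?lhs = (\<Sum>xs\<in>permutations_of_multiset (copies k n). \<Sum>bs\<in>blockings xs. h (excess bs))"
    by (simp add: sum_blockings)
  also have "\<dots> = (\<Sum>bs\<in>(\<Union>xs\<in>permutations_of_multiset (copies k n). blockings xs). h (excess bs))"
    by (rule sum.UNION_disjoint[symmetric], simp, simp add: finite_blockings) (auto simp: blockings_def)
  also have "\<dots> = (\<Sum>bs\<in>(\<Union>ps\<in>?T. permutations_of_multiset (assemble ps)). h (excess bs))"
    by (simp only: blockings_copies)
  also have "\<dots> = (\<Sum>ps\<in>?T. \<Sum>bs\<in>permutations_of_multiset (assemble ps). h (excess bs))"
    by (rule sum.UNION_disjoint, rule fin, simp)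
      (auto simp: permutations_of_multiset_def dest: assemble_inject)
  also have "\<dots> = (\<Sum>ps\<in>?T. ?F ps)"
  proof (rule sum.cong)
    fix ps
    have "real (card (permutations_of_multiset (assemble ps))) * real (\<Prod>p\<in>#mset ps. symmetry_factor p)
        = fact (\<Sum>p\<in>#mset ps. size p)"
      using card_permutations_of_multiset_aux[of "assemble ps"]
      by (metis of_nat_mult of_nat_fact size_assemble prod_fact_count_assemble)
    moreover have "(\<Prod>p\<in>#mset ps. symmetry_factor p) \<noteq> 0"
      by (auto simp: prod_mset_zero_iff symmetry_factor_def)
    ultimately have "real (card (permutations_of_multiset (assemble ps)))
        = fact (\<Sum>p\<in>#mset ps. size p) / real (\<Prod>p\<in>#mset ps. symmetry_factor p)"
      by (metis nonzero_mult_div_cancel_right of_nat_eq_0_iff)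
    moreover have "(\<Sum>bs\<in>permutations_of_multiset (assemble ps). h (excess bs)) =
      (\<Sum>bs\<in>permutations_of_multiset (assemble ps). h (\<Sum>p\<in>#mset ps. \<Sum>l\<in>#p. l - 1))"
      by (rule sum.cong) (auto simp: excess_assemble permutations_of_multiset_def)
    ultimately show "(\<Sum>bs\<in>permutations_of_multiset (assemble ps). h (excess bs)) = ?F ps"
      by simp
  qed simp
  finally show ?thesis .
qed

section \<open>Four copies of each letter\<close>

text \<open>
  The possible numbers of parts $1, 2, 3, 4$ in a partition of $4$.
\<close>

lemma weight_4_cases:
  fixes a b c d :: nat
  assumes w: "a + 2 * b + 3 * c + 4 * d = 4"
  shows "(a, b, c, d) \<in> {(4, 0, 0, 0), (2, 1, 0, 0), (1, 0, 1, 0), (0, 2, 0, 0), (0, 0, 0, 1)}"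
proof -
  have "d \<le> 1" "c \<le> 1" "b \<le> 2" using w by linarith+
  then consider "d = 0" "c = 0" "b = 0" | "d = 0" "c = 0" "b = 1" | "d = 0" "c = 0" "b = 2"
    | "d = 0" "c = 1" | "d = 1"
    by linarith
  then show ?thesis
  proof cases
    case 1
    with w show ?thesis by simp
  next
    case 2
    with w show ?thesis by simp
  next
    case 3
    with w show ?thesis by simp
  next
    case 4
    with w have "b = 0" by linarith
    with w 4 have "a = 1" by linarith
    with 4 \<open>b = 0\<close> show ?thesis by simp
  next
    case 5
    with w have "b = 0" "a = 0" "c = 0" by linarith+
    with 5 show ?thesis by simp
  qed
qed

lemma partitions_4:
  "partitions 4 = {{#1, 1, 1, 1#}, {#2, 1, 1#}, {#3, 1#}, {#2, 2#}, {#4#}}" (is "_ = ?P")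
proof
  show "?P \<subseteq> partitions 4" by (auto simp: partitions_def)
  show "partitions 4 \<subseteq> ?P"
  proof
    fix p :: "nat multiset" assume "p \<in> partitions 4"
    then have p: "0 \<notin># p" "sum_mset p = 4" by (auto simp: partitions_def)
    have "l \<in> {1..4}" if "l \<in># p" for l
    proof -
      have "l \<le> 4" using that p(2) by (metis sum_mset.remove le_add1)
      moreover have "l \<noteq> 0" using that p(1) by metis
      ultimately show ?thesis by simp
    qed
    then have sub: "set_mset p \<subseteq> {1..4}" by blast
    have iv: "{1..4} = {1, 2, 3, 4::nat}" by auto
    have eq: "p = replicate_mset (count p 1) 1 + replicate_mset (count p 2) 2
          + replicate_mset (count p 3) 3 + replicate_mset (count p 4) 4"
      using sub by (intro multiset_eqI) (auto simp: iv count_eq_zero_iff)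
    have weight: "count p 1 + 2 * count p 2 + 3 * count p 3 + 4 * count p 4 = 4"
      using p(2) by (subst (asm) eq) simp
    have rep: "replicate_mset 1 l = {#l#}" "replicate_mset 2 l = {#l, l#}"
      "replicate_mset 4 l = {#l, l, l, l#}" for l :: nat
      by (simp_all add: numeral_eq_Suc)
    from weight_4_cases[OF weight] show "p \<in> ?P"
    proof (elim insertE emptyE Pair_inject)
      assume c: "count p 1 = 4" "count p 2 = 0" "count p 3 = 0" "count p 4 = 0"
      have "p = {#1, 1, 1, 1#}" using eq unfolding c rep replicate_mset_0 by simp
      then show ?thesis by blast
    next
      assume c: "count p 1 = 2" "count p 2 = 1" "count p 3 = 0" "count p 4 = 0"
      have "p = {#2, 1, 1#}" using eq unfolding c rep replicate_mset_0 by simp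
      then show ?thesis by blast
    next
      assume c: "count p 1 = 1" "count p 2 = 0" "count p 3 = 1" "count p 4 = 0"
      have "p = {#3, 1#}" using eq unfolding c rep replicate_mset_0 by simp
      then show ?thesis by blast
    next
      assume c: "count p 1 = 0" "count p 2 = 2" "count p 3 = 0" "count p 4 = 0"
      have "p = {#2, 2#}" using eq unfolding c rep replicate_mset_0 by simp
      then show ?thesis by blast
    next
      assume c: "count p 1 = 0" "count p 2 = 0" "count p 3 = 0" "count p 4 = 1"
      have "p = {#4#}" using eq unfolding c rep replicate_mset_0 by simp
      then show ?thesis by blast
    qed
  qed
qed

text \<open>
  Lists over five values are grouped by how often each value occurs. A group consists of all
  permutations of one multiset, so its size is a multinomial coefficient.
\<close>

lemma sum_lists_by_counts:
  fixes F :: "'a multiset \<Rightarrow> real"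
  assumes "distinct [a, b, c, d, e]"
  shows "(\<Sum>ps\<in>{ps. set ps \<subseteq> {a, b, c, d, e} \<and> length ps = n}. F (mset ps)) =
    (\<Sum>(s, t, u, v, w)\<in>{(s, t, u, v, w). s + t + u + v + w = n}. multinomial5 n s t u v w *
      F (replicate_mset s a + replicate_mset t b + replicate_mset u c + replicate_mset v d + replicate_mset w e))"
proof -
  define I where "I = {(s, t, u, v, w). s + t + u + v + w = n}"
  define M where "M = (\<lambda>(s, t, u, v, w). replicate_mset s a + replicate_mset t b
    + replicate_mset u c + replicate_mset v d + replicate_mset w e)"
  let ?T = "{ps. set ps \<subseteq> {a, b, c, d, e} \<and> length ps = n}"
  have "finite I"
    by (rule finite_subset[of _ "{..n} \<times> {..n} \<times> {..n} \<times> {..n} \<times> {..n}"]) (auto simp: I_def)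
  have ne: "b \<noteq> a" "c \<noteq> a" "c \<noteq> b" "d \<noteq> a" "d \<noteq> b" "d \<noteq> c" "e \<noteq> a" "e \<noteq> b" "e \<noteq> c" "e \<noteq> d"
    using assms by auto
  have count_M: "count (M (s, t, u, v, w)) a = s" "count (M (s, t, u, v, w)) b = t"
    "count (M (s, t, u, v, w)) c = u" "count (M (s, t, u, v, w)) d = v"
    "count (M (s, t, u, v, w)) e = w" for s t u v w
    using ne ne[symmetric] by (simp_all add: M_def)
  have set_M: "set_mset (M x) \<subseteq> {a, b, c, d, e}" for x
    by (cases x) (auto simp: M_def split: if_splits)
  have inj: "x = y" if "M x = M y" for x y
    using that by (cases x; cases y) (metis count_M)
  have T: "?T = (\<Union>x\<in>I. permutations_of_multiset (M x))"
  proof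
    show "?T \<subseteq> (\<Union>x\<in>I. permutations_of_multiset (M x))"
    proof
      fix ps assume ps: "ps \<in> ?T"
      let ?x = "(count (mset ps) a, count (mset ps) b, count (mset ps) c, count (mset ps) d, count (mset ps) e)"
      have M: "M ?x = mset ps"
      proof (rule multiset_eqI)
        fix x
        have "count (M ?x) x = 0" "count (mset ps) x = 0" if "x \<notin> {a, b, c, d, e}"
          using that ps set_M[of ?x] by (auto simp: count_eq_zero_iff)
        then show "count (M ?x) x = count (mset ps) x"
          by (cases "x \<in> {a, b, c, d, e}") (auto simp: count_M)
      qed
      have "size (M ?x) = n" unfolding M using ps by simp
      then have "?x \<in> I" by (simp add: M_def I_def)
      with M show "ps \<in> (\<Union>x\<in>I. permutations_of_multiset (M x))"
        by (intro UN_I[of ?x]) (auto simp: permutations_of_multiset_def)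
    qed
    have "set ps \<subseteq> {a, b, c, d, e} \<and> length ps = n" if "x \<in> I" "mset ps = M x" for x ps
    proof -
      have "size (M x) = n" using that(1) by (auto simp: M_def I_def)
      with that(2) set_M show ?thesis by (metis set_mset_mset size_mset)
    qed
    then show "(\<Union>x\<in>I. permutations_of_multiset (M x)) \<subseteq> ?T"
      unfolding permutations_of_multiset_def by blast
  qed
  have card: "real (card (permutations_of_multiset (M (s, t, u, v, w)))) = multinomial5 n s t u v w"
    if "(s, t, u, v, w) \<in> I" for s t u v w
  proof -
    let ?M = "M (s, t, u, v, w)"
    have size: "size ?M = n" using that by (simp add: M_def I_def)
    have "(\<Prod>x\<in>set_mset ?M. fact (count ?M x)) = (\<Prod>x\<in>{a, b, c, d, e}. fact (count ?M x) :: nat)"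
      by (rule prod.mono_neutral_left) (use set_M in \<open>auto simp: not_in_iff\<close>)
    also have "\<dots> = fact s * fact t * fact u * fact v * fact w"
      using ne ne[symmetric] by (simp add: count_M)
    finally have "card (permutations_of_multiset ?M) * (fact s * fact t * fact u * fact v * fact w) = fact n"
      using card_permutations_of_multiset_aux[of ?M] by (simp only: size)
    from arg_cong[OF this, of real]
    have "real (card (permutations_of_multiset ?M)) * (fact s * fact t * fact u * fact v * fact w) = fact n"
      by (simp only: of_nat_mult of_nat_fact)
    then show ?thesis
      by (simp add: multinomial5_def eq_divide_eq)
  qed
  have "(\<Sum>ps\<in>?T. F (mset ps)) = (\<Sum>x\<in>I. \<Sum>ps\<in>permutations_of_multiset (M x). F (mset ps))"
    unfolding T by (rule sum.UNION_disjoint, rule \<open>finite I\<close>, simp)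
      (metis disjoint_iff inj permutations_of_multisetD)
  also have "\<dots> = (\<Sum>x\<in>I. real (card (permutations_of_multiset (M x))) * F (M x))"
    by (simp add: permutations_of_multiset_def)
  also have "\<dots> = (\<Sum>(s, t, u, v, w)\<in>I. multinomial5 n s t u v w * F (M (s, t, u, v, w)))"
    by (rule sum.cong) (auto simp: card)
  finally show ?thesis by (simp add: I_def M_def)
qed

lemma alpha_eq_sum_partitions:
  "real (alpha n r) = (\<Sum>ps\<in>{ps. set ps \<subseteq> partitions 4 \<and> length ps = n}.
     (let m = (\<Sum>p\<in>#mset ps. \<Sum>l\<in>#p. l - 1) in (-1) ^ (m - r) * real (m choose r)) *
     (fact (\<Sum>p\<in>#mset ps. size p) / real (\<Prod>p\<in>#mset ps. symmetry_factor p)))"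
proof -
  let ?W = "permutations_of_multiset (copies 4 n)"
  have "real (alpha n r) = (\<Sum>xs\<in>?W. if matches xs = r then 1 else 0)"
    by (simp add: alpha_def four_copies_def copies_def sum.If_cases Int_def)
  also have "\<dots> = (\<Sum>xs\<in>?W. \<Sum>m\<le>matches xs. real (matches xs choose m) * ((-1) ^ (m - r) * real (m choose r)))"
    by (simp only: binomial_orthogonality)
  finally show ?thesis
    by (simp only: sum_permutations_partitions[where h = "\<lambda>m. (-1) ^ (m - r) * real (m choose r)"] Let_def)
qed

theorem theorem2:
  fixes n r :: nat
  assumes "n \<ge> 1" and "r \<le> 3 * n"
  shows "real (alpha n r) =
    (\<Sum>(s, t, u, v, w) \<in> {(s, t, u, v, w). s + t + u + v + w = n \<and> t + 2 * u + 2 * v + 3 * w \<ge> r}.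
      (-1) powi (int t + int w - int r)
      * real ((t + 2 * u + 2 * v + 3 * w) choose r)
      * multinomial5 n s t u v w
      * (fact (4 * s + 3 * t + 2 * u + 2 * v + w)
          / (fact 4 ^ s * fact 2 ^ t * fact 2 ^ v)))"
proof -
  let ?I = "{(s, t, u, v, w). s + t + u + v + w = n}"
  have "finite ?I"
    by (rule finite_subset[of _ "{..n} \<times> {..n} \<times> {..n} \<times> {..n} \<times> {..n}"]) auto
  \<comment> \<open>Counting the parts 1 and 2 already tells the five partitions apart.\<close>
  have dist: "distinct [{#1, 1, 1, 1::nat#}, {#2, 1, 1#}, {#3, 1#}, {#2, 2#}, {#4#}]"
    by (insert distinct_map[of "\<lambda>p. (count p 1, count p 2)" "[{#1, 1, 1, 1::nat#}, {#2, 1, 1#}, {#3, 1#}, {#2, 2#}, {#4#}]"]) simp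
  \<comment> \<open>The exponents differ by the even number \<open>2 * u + 2 * v + 2 * w\<close>.\<close>
  have sign: "(-1 :: real) powi (int t + int w - int r) = (-1) ^ (t + 2 * u + 2 * v + 3 * w - r)"
    if "t + 2 * u + 2 * v + 3 * w \<ge> r" for t u v w
  proof -
    have "even (int t + int w - int r) \<longleftrightarrow> even (t + 2 * u + 2 * v + 3 * w - r)"
      using that by auto
    then show ?thesis by (simp add: power_int_minus_left minus_one_power_iff)
  qed
  define N :: "nat \<Rightarrow> nat \<Rightarrow> nat \<Rightarrow> nat \<Rightarrow> nat \<Rightarrow> nat multiset multiset" where
    "N s t u v w = replicate_mset s {#1, 1, 1, 1#} + replicate_mset t {#2, 1, 1#}
      + replicate_mset u {#3, 1#} + replicate_mset v {#2, 2#} + replicate_mset w {#4#}" for s t u v w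
  have matched: "(\<Sum>p\<in>#N s t u v w. \<Sum>l\<in>#p. l - 1) = t + 2 * u + 2 * v + 3 * w" for s t u v w
    by (simp add: N_def)
  have blocks: "(\<Sum>p\<in>#N s t u v w. size p) = 4 * s + 3 * t + 2 * u + 2 * v + w" for s t u v w
    by (simp add: N_def)
  have symmetry: "real (\<Prod>p\<in>#N s t u v w. symmetry_factor p) = fact 4 ^ s * fact 2 ^ t * fact 2 ^ v" for s t u v w
    by (simp add: N_def symmetry_factor_def fact_numeral)
  have "real (alpha n r) = (\<Sum>(s, t, u, v, w)\<in>?I. multinomial5 n s t u v w *
      (((-1) ^ (t + 2 * u + 2 * v + 3 * w - r) * real ((t + 2 * u + 2 * v + 3 * w) choose r)) *
       (fact (4 * s + 3 * t + 2 * u + 2 * v + w) / (fact 4 ^ s * fact 2 ^ t * fact 2 ^ v))))"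
    unfolding alpha_eq_sum_partitions partitions_4 Let_def
    by (subst sum_lists_by_counts[OF dist]) (simp only: N_def[symmetric] matched blocks symmetry)
  also have "\<dots> = (\<Sum>(s, t, u, v, w) \<in> {(s, t, u, v, w). s + t + u + v + w = n \<and> t + 2 * u + 2 * v + 3 * w \<ge> r}.
      (-1) powi (int t + int w - int r)
      * real ((t + 2 * u + 2 * v + 3 * w) choose r)
      * multinomial5 n s t u v w
      * (fact (4 * s + 3 * t + 2 * u + 2 * v + w)
          / (fact 4 ^ s * fact 2 ^ t * fact 2 ^ v)))"
    \<comment> \<open>Fewer than \<open>r\<close> chosen matches contribute nothing, since the binomial coefficient is zero.\<close>
    by (rule sum.mono_neutral_cong_right) (use \<open>finite ?I\<close> in \<open>auto simp: sign binomial_eq_0\<close>)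
  finally show ?thesis .
qed

end
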